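(* Let $L$ be a relatively complemented lattice. Then the semilattice $\mathrm{Con_c}\,L$ of compact congruences of $L$ satisfies $\mathrm{URP}^+$.
   Context: For a lattice $L$ (not assumed to be bounded), $\mathrm{Con}\,L$ is the lattice of all congruences of $L$ under inclusion, and $\mathrm{Con_c}\,L$ is the join-semilattice with zero consisting of all compact (equivalently, finitely generated) congruences of $L$, with the join taken in $\mathrm{Con}\,L$. A lattice is relatively complemented if every $b$ with $a\le b\le c$ has a complement in the interval $[a,c]$, i.e. there is $x\in[a,c]$ with $b\wedge x=a$ and $b\vee x=c$. Let $S$ be a join-semilattice and let $e\in S$. We say that $S$ satisfies $\mathrm{URP}^+$ at $e$ if for every set $I$ and all families $\langle a_i\mid i\in I\rangle$ and $\langle b_i\mid i\in I\rangle$ of elements of $S$ such that $a_i\vee b_i=e$ for all $i\in I$, there are elements $c_{i,j}\in S$ (for $i,j\in I$) such that: (i) $c_{i,j}\le a_i$ and $c_{i,j}\le b_j$, for all $i,j\in I$; (ii) $a_i\le a_j\vee c_{i,j}$ and $b_j\le b_i\vee c_{i,j}$, for all $i,j\in I$; (iii) $c_{i,k}\le c_{i,j}\vee c_{j,k}$, for all $i,j,k\in I$. We say that $S$ satisfies (or has) $\mathrm{URP}^+$ if it satisfies $\mathrm{URP}^+$ at each of its elements. *)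

theory Defs
  imports Main
begin

section \<open>The congruence lattice of a lattice\<close>

definition lattice_congruence :: "('a::lattice \<times> 'a) set \<Rightarrow> bool" where
  "lattice_congruence \<theta> \<longleftrightarrow>
     equiv UNIV \<theta> \<and>
     (\<forall>a a' b b'. (a, a') \<in> \<theta> \<longrightarrow> (b, b') \<in> \<theta> \<longrightarrow>
        (inf a b, inf a' b') \<in> \<theta> \<and> (sup a b, sup a' b') \<in> \<theta>)"

lemma lattice_congruence_UNIV: "lattice_congruence UNIV"
  by (auto simp: lattice_congruence_def equiv_def refl_on_def sym_def trans_def)

lemma lattice_congruence_Inter:
  assumes "\<And>\<theta>. \<theta> \<in> A \<Longrightarrow> lattice_congruence \<theta>"
  shows "lattice_congruence (\<Inter>A)"
proof -
  have eq: "equiv UNIV \<theta>" if "\<theta> \<in> A" for \<theta>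
    using assms[OF that] by (simp add: lattice_congruence_def)
  have "refl (\<Inter>A)"
    unfolding refl_on_def using eq by (auto simp: equiv_def dest: refl_onD)
  moreover have "sym (\<Inter>A)"
    using eq unfolding equiv_def by (blast intro: symI dest: symD)
  moreover have "trans (\<Inter>A)"
    using eq unfolding equiv_def by (blast intro: transI dest: transD)
  ultimately have "equiv UNIV (\<Inter>A)" by (simp add: equiv_def)
  moreover have "(inf a b, inf a' b') \<in> \<Inter>A \<and> (sup a b, sup a' b') \<in> \<Inter>A"
    if "(a, a') \<in> \<Inter>A" "(b, b') \<in> \<Inter>A" for a a' b b'
    using that assms unfolding lattice_congruence_def by blast
  ultimately show ?thesis
    unfolding lattice_congruence_def by blast
qed

typedef (overloaded) 'a con = "{\<theta> :: ('a::lattice \<times> 'a) set. lattice_congruence \<theta>}"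
  using lattice_congruence_UNIV by blast

setup_lifting type_definition_con

instantiation con :: (lattice) complete_lattice
begin

lift_definition less_eq_con :: "'a con \<Rightarrow> 'a con \<Rightarrow> bool" is "(\<subseteq>)" .

lift_definition less_con :: "'a con \<Rightarrow> 'a con \<Rightarrow> bool" is "(\<subset>)" .

lift_definition Inf_con :: "'a con set \<Rightarrow> 'a con" is Inter
  by (rule lattice_congruence_Inter)

lift_definition inf_con :: "'a con \<Rightarrow> 'a con \<Rightarrow> 'a con" is "(\<inter>)"
proof -
  fix \<theta> \<psi> :: "('a \<times> 'a) set"
  assume "lattice_congruence \<theta>" "lattice_congruence \<psi>"
  then show "lattice_congruence (\<theta> \<inter> \<psi>)"
    using lattice_congruence_Inter[of "{\<theta>, \<psi>}"] by auto
qed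

definition Sup_con :: "'a con set \<Rightarrow> 'a con" where
  "Sup_con A = Inf {\<psi>. \<forall>\<theta>\<in>A. \<theta> \<le> \<psi>}"

definition sup_con :: "'a con \<Rightarrow> 'a con \<Rightarrow> 'a con" where
  "sup_con \<theta> \<psi> = Inf {\<chi>. \<theta> \<le> \<chi> \<and> \<psi> \<le> \<chi>}"

definition bot_con :: "'a con" where
  "bot_con = Inf UNIV"

definition top_con :: "'a con" where
  "top_con = Inf {}"

instance
proof
  fix x y z :: "'a con" and A :: "'a con set"
  have lower: "Inf B \<le> w" if "w \<in> B" for w :: "'a con" and B
    using that by transfer auto
  have greatest: "w \<le> Inf B" if "\<And>v. v \<in> B \<Longrightarrow> w \<le> v" for w :: "'a con" and B
    using that by transfer auto
  show "x < y \<longleftrightarrow> x \<le> y \<and> \<not> y \<le> x" by transfer auto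
  show "x \<le> x" by transfer auto
  show "x \<le> z" if "x \<le> y" "y \<le> z" using that by transfer auto
  show "x = y" if "x \<le> y" "y \<le> x" using that by transfer auto
  show "inf x y \<le> x" "inf x y \<le> y" by (transfer, auto)+
  show "x \<le> inf y z" if "x \<le> y" "x \<le> z" using that by transfer auto
  show "x \<le> sup x y" "y \<le> sup x y"
    unfolding sup_con_def by (auto intro: greatest)
  show "sup y z \<le> x" if "y \<le> x" "z \<le> x"
    unfolding sup_con_def using that by (auto intro: lower)
  show "Inf A \<le> x" if "x \<in> A" using that by (rule lower)
  show "z \<le> Inf A" if "\<And>x. x \<in> A \<Longrightarrow> z \<le> x" using that by (rule greatest)
  show "x \<le> Sup A" if "x \<in> A"
    unfolding Sup_con_def using that by (auto intro: greatest)
  show "Sup A \<le> z" if "\<And>x. x \<in> A \<Longrightarrow> x \<le> z"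
    unfolding Sup_con_def using that by (auto intro: lower)
  show "Inf ({} :: 'a con set) = top" by (simp add: top_con_def)
  show "Sup ({} :: 'a con set) = bot" by (simp add: Sup_con_def bot_con_def)
qed

end


section \<open>The semilattice of compact congruences\<close>

definition compact_element :: "'b::complete_lattice \<Rightarrow> bool" where
  "compact_element x \<longleftrightarrow>
     (\<forall>A. x \<le> Sup A \<longrightarrow> (\<exists>F. finite F \<and> F \<subseteq> A \<and> x \<le> Sup F))"

lemma compact_element_bot: "compact_element bot"
  unfolding compact_element_def by (auto intro: exI[of _ "{}"])

lemma compact_element_sup:
  assumes "compact_element x" "compact_element y"
  shows "compact_element (sup x y)"
  unfolding compact_element_def
proof (intro allI impI)
  fix A assume "sup x y \<le> Sup A"
  then have "x \<le> Sup A" "y \<le> Sup A" by auto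
  then obtain F G where F: "finite F" "F \<subseteq> A" "x \<le> Sup F"
    and G: "finite G" "G \<subseteq> A" "y \<le> Sup G"
    using assms unfolding compact_element_def by metis
  have "sup x y \<le> Sup (F \<union> G)"
    unfolding Sup_union_distrib using F(3) G(3) by (rule sup_mono)
  then show "\<exists>H. finite H \<and> H \<subseteq> A \<and> sup x y \<le> Sup H"
    using F G by (metis Un_least finite_UnI)
qed

typedef (overloaded) 'a con_c = "{\<theta> :: 'a::lattice con. compact_element \<theta>}"
  using compact_element_bot by blast

setup_lifting type_definition_con_c

instantiation con_c :: (lattice) bounded_semilattice_sup_bot
begin

lift_definition less_eq_con_c :: "'a con_c \<Rightarrow> 'a con_c \<Rightarrow> bool" is "(\<le>)" .

lift_definition less_con_c :: "'a con_c \<Rightarrow> 'a con_c \<Rightarrow> bool" is "(<)" .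

lift_definition sup_con_c :: "'a con_c \<Rightarrow> 'a con_c \<Rightarrow> 'a con_c" is sup
  by (rule compact_element_sup)

lift_definition bot_con_c :: "'a con_c" is bot
  by (rule compact_element_bot)

instance
proof
  fix x y z :: "'a con_c"
  show "x < y \<longleftrightarrow> x \<le> y \<and> \<not> y \<le> x" by transfer (rule less_le_not_le)
  show "x \<le> x" by transfer (rule order_refl)
  show "x \<le> z" if "x \<le> y" "y \<le> z" using that by transfer (rule order_trans)
  show "x = y" if "x \<le> y" "y \<le> x" using that by transfer (rule antisym)
  show "x \<le> sup x y" by transfer (rule sup_ge1)
  show "y \<le> sup x y" by transfer (rule sup_ge2)
  show "sup y z \<le> x" if "y \<le> x" "z \<le> x" using that by transfer (rule sup_least)
  show "bot \<le> x" by transfer (rule bot_least)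
qed

end


section \<open>Relatively complemented lattices and the property \<open>URP\<^sup>+\<close>\<close>

definition relatively_complemented :: "'a::lattice itself \<Rightarrow> bool" where
  "relatively_complemented _ \<longleftrightarrow>
     (\<forall>a b c :: 'a. a \<le> b \<longrightarrow> b \<le> c \<longrightarrow>
        (\<exists>x. a \<le> x \<and> x \<le> c \<and> inf b x = a \<and> sup b x = c))"

text \<open>
  A definition in HOL cannot quantify over types, so the type \<open>'i\<close> from which the index sets
  \<open>I\<close> are drawn is a parameter. The property for all index sets is obtained by leaving \<open>'i\<close>
  as a type variable in a theorem.
\<close>

definition URP_plus_at :: "'i itself \<Rightarrow> 's::semilattice_sup \<Rightarrow> bool" where
  "URP_plus_at _ e \<longleftrightarrow>
     (\<forall>(I :: 'i set) (a :: 'i \<Rightarrow> 's) (b :: 'i \<Rightarrow> 's).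
        (\<forall>i\<in>I. sup (a i) (b i) = e) \<longrightarrow>
        (\<exists>c :: 'i \<Rightarrow> 'i \<Rightarrow> 's.
           (\<forall>i\<in>I. \<forall>j\<in>I. c i j \<le> a i \<and> c i j \<le> b j) \<and>
           (\<forall>i\<in>I. \<forall>j\<in>I. a i \<le> sup (a j) (c i j) \<and> b j \<le> sup (b i) (c i j)) \<and>
           (\<forall>i\<in>I. \<forall>j\<in>I. \<forall>k\<in>I. c i k \<le> sup (c i j) (c j k))))"

definition URP_plus :: "'i itself \<Rightarrow> 's::semilattice_sup itself \<Rightarrow> bool" where
  "URP_plus _ _ \<longleftrightarrow> (\<forall>e :: 's. URP_plus_at TYPE('i) e)"

end

theory Submission
  imports Defs
begin

text \<open>
  In a relatively complemented lattice every compact congruence is of the form \<open>\<Theta>(u,v)\<close> with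
  \<open>u \<le> v\<close>, and each compact congruence below \<open>\<Theta>(u,v)\<close> can be written both as \<open>\<Theta>(u,s)\<close> and as
  \<open>\<Theta>(t,v)\<close> with \<open>s, t \<in> [u,v]\<close>. If \<open>a \<squnion> b = \<Theta>(u,v)\<close>, then, since congruences permute, some
  \<open>z \<in> [u,v]\<close> satisfies \<open>u \<equiv> z\<close> modulo \<open>a\<close> and \<open>z \<equiv> v\<close> modulo \<open>b\<close>. Enlarging and shrinking
  \<open>z\<close> gives \<open>u \<le> y \<le> x \<le> v\<close> with \<open>a = \<Theta>(u,x)\<close> and \<open>b = \<Theta>(y,v)\<close>. For a family, let \<open>c\<^sub>i\<^sub>j\<close> be
  the least congruence forcing \<open>x\<^sub>i \<le> y\<^sub>j\<close>; condition (iii) reads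
  \<open>x\<^sub>i \<le> y\<^sub>j \<le> x\<^sub>j \<le> y\<^sub>k\<close>.
\<close>

section \<open>Congruences of a lattice\<close>

lemma lattice_congruence_Rep_con: "lattice_congruence (Rep_con \<theta>)"
  using Rep_con by blast

lemma Rep_con_refl [simp]: "(x, x) \<in> Rep_con \<theta>"
  using lattice_congruence_Rep_con[of \<theta>]
  by (auto simp: lattice_congruence_def equiv_def dest: refl_onD)

lemma Rep_con_sym: "(x, y) \<in> Rep_con \<theta> \<Longrightarrow> (y, x) \<in> Rep_con \<theta>"
  using lattice_congruence_Rep_con[of \<theta>]
  by (auto simp: lattice_congruence_def equiv_def dest: symD)

lemma Rep_con_trans: "(x, y) \<in> Rep_con \<theta> \<Longrightarrow> (y, z) \<in> Rep_con \<theta> \<Longrightarrow> (x, z) \<in> Rep_con \<theta>"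
  using lattice_congruence_Rep_con[of \<theta>]
  by (auto simp: lattice_congruence_def equiv_def dest: transD)

lemma Rep_con_inf:
  "(x, x') \<in> Rep_con \<theta> \<Longrightarrow> (y, y') \<in> Rep_con \<theta> \<Longrightarrow> (inf x y, inf x' y') \<in> Rep_con \<theta>"
  using lattice_congruence_Rep_con[of \<theta>] by (auto simp: lattice_congruence_def)

lemma Rep_con_sup:
  "(x, x') \<in> Rep_con \<theta> \<Longrightarrow> (y, y') \<in> Rep_con \<theta> \<Longrightarrow> (sup x y, sup x' y') \<in> Rep_con \<theta>"
  using lattice_congruence_Rep_con[of \<theta>] by (auto simp: lattice_congruence_def)

lemma Rep_con_mono: "\<theta> \<le> \<psi> \<Longrightarrow> (x, y) \<in> Rep_con \<theta> \<Longrightarrow> (x, y) \<in> Rep_con \<psi>"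
  by (auto simp: less_eq_con.rep_eq)

text \<open>The unary polynomial that meets with \<open>y\<close> and then joins with
  \<open>x\<close> sends \<open>u\<close> to \<open>x\<close> and \<open>v\<close> to
  \<open>y\<close>.\<close>

lemma Rep_con_convex:
  assumes "(u, v) \<in> Rep_con \<theta>" "u \<le> x" "x \<le> y" "y \<le> v"
  shows "(x, y) \<in> Rep_con \<theta>"
proof -
  have "(sup (inf u y) x, sup (inf v y) x) \<in> Rep_con \<theta>"
    using assms(1) by (intro Rep_con_sup Rep_con_inf) auto
  moreover have "sup (inf u y) x = x" "sup (inf v y) x = y"
    using assms by (auto simp: sup_absorb2 inf_absorb2 le_infI1 sup_absorb1)
  ultimately show ?thesis by simp
qed

lemma Rep_con_inf_sup: "(inf x y, sup x y) \<in> Rep_con \<theta> \<longleftrightarrow> (x, y) \<in> Rep_con \<theta>"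
proof
  assume *: "(inf x y, sup x y) \<in> Rep_con \<theta>"
  have "(inf x y, x) \<in> Rep_con \<theta>" "(inf x y, y) \<in> Rep_con \<theta>"
    using * by (auto intro: Rep_con_convex le_supI1 le_supI2)
  then show "(x, y) \<in> Rep_con \<theta>" by (blast intro: Rep_con_sym Rep_con_trans)
next
  assume *: "(x, y) \<in> Rep_con \<theta>"
  have "(inf x y, y) \<in> Rep_con \<theta>" using Rep_con_inf[OF * Rep_con_refl[of y]] by simp
  moreover have "(sup x y, y) \<in> Rep_con \<theta>" using Rep_con_sup[OF * Rep_con_refl[of y]] by simp
  ultimately show "(inf x y, sup x y) \<in> Rep_con \<theta>" by (blast intro: Rep_con_sym Rep_con_trans)
qed

text \<open>Joining with \<open>y\<close> and meeting with \<open>x\<close> carry the two transposed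
  intervals onto each other. This is the tool by which intervals are moved throughout the
  proof.\<close>

lemma Rep_con_perspective: "(inf x y, x) \<in> Rep_con \<theta> \<longleftrightarrow> (y, sup x y) \<in> Rep_con \<theta>"
proof
  assume "(inf x y, x) \<in> Rep_con \<theta>"
  from Rep_con_sup[OF this Rep_con_refl[of y]] show "(y, sup x y) \<in> Rep_con \<theta>"
    by (simp add: sup_absorb2)
next
  assume "(y, sup x y) \<in> Rep_con \<theta>"
  from Rep_con_inf[OF this Rep_con_refl[of x]] show "(inf x y, x) \<in> Rep_con \<theta>"
    by (simp add: inf.commute inf_absorb2)
qed

lemma Rep_con_complement:
  assumes "inf x y = u" "sup x y = v"
  shows "(u, x) \<in> Rep_con \<theta> \<longleftrightarrow> (y, v) \<in> Rep_con \<theta>"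
  using Rep_con_perspective[of x y \<theta>] assms by simp

text \<open>A congruence is determined by the intervals that it collapses, so only conditions on
  comparable pairs have to be checked. Closure under translations makes \<open>R\<close> pass to
  subintervals.\<close>

lemma lattice_congruenceI_intervals:
  fixes R :: "'a::lattice \<Rightarrow> 'a \<Rightarrow> bool"
  assumes refl: "\<And>x. R x x"
    and trans: "\<And>x y z. x \<le> y \<Longrightarrow> y \<le> z \<Longrightarrow> R x y \<Longrightarrow> R y z \<Longrightarrow> R x z"
    and sup: "\<And>x y t. x \<le> y \<Longrightarrow> R x y \<Longrightarrow> R (sup x t) (sup y t)"
    and inf: "\<And>x y t. x \<le> y \<Longrightarrow> R x y \<Longrightarrow> R (inf x t) (inf y t)"
  shows "lattice_congruence {(x, y). R (inf x y) (sup x y)}" (is "lattice_congruence ?\<theta>")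
proof -
  have convex: "R x y" if "R u v" "u \<le> x" "x \<le> y" "y \<le> v" for u v x y
  proof -
    have "u \<le> v" using that by auto
    have "R (sup (inf u y) x) (sup (inf v y) x)"
      using that \<open>u \<le> v\<close> by (intro sup inf inf_mono) auto
    moreover have "sup (inf u y) x = x" "sup (inf v y) x = y"
      using that by (auto simp: sup_absorb2 inf_absorb2 le_infI1 sup_absorb1)
    ultimately show ?thesis by simp
  qed
  have tr: "(x, z) \<in> ?\<theta>" if "(x, y) \<in> ?\<theta>" "(y, z) \<in> ?\<theta>" for x y z
  proof -
    have xy: "R (inf x y) (sup x y)" and yz: "R (inf y z) (sup y z)" using that by auto
    \<comment> \<open>The interval between the meet and the join of \<open>x\<close> and
      \<open>y\<close> is prolonged upwards and downwards by translates of the one for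
      \<open>y\<close> and \<open>z\<close>. The result contains both \<open>x\<close> and
      \<open>z\<close>, and convexity cuts out their interval.\<close>
    have "R (sup (inf y z) (sup x y)) (sup (sup y z) (sup x y))"
      by (rule sup[OF _ yz]) (simp add: le_supI1)
    moreover have "sup (inf y z) (sup x y) = sup x y" by (simp add: sup_absorb2 le_infI1)
    ultimately have 1: "R (sup x y) (sup (sup y z) (sup x y))" by simp
    have "R (inf (inf y z) (inf x y)) (inf (sup y z) (inf x y))"
      by (rule inf[OF _ yz]) (simp add: le_supI1)
    moreover have "inf (sup y z) (inf x y) = inf x y" by (simp add: inf_absorb2 le_supI1)
    ultimately have 2: "R (inf (inf y z) (inf x y)) (inf x y)" by simp
    have "R (inf (inf y z) (inf x y)) (sup x y)"
      by (rule trans[OF _ _ 2 xy]) (auto simp: le_supI1 le_infI1 le_infI2)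
    then have "R (inf (inf y z) (inf x y)) (sup (sup y z) (sup x y))"
      using 1 by (rule trans[rotated 2]) (auto simp: le_supI1 le_infI1 le_infI2)
    then have "R (inf x z) (sup x z)"
      by (rule convex) (auto simp: le_supI1 le_supI2 le_infI1 le_infI2)
    then show ?thesis by simp
  qed
  have sy: "(y, x) \<in> ?\<theta>" if "(x, y) \<in> ?\<theta>" for x y
    using that by (simp add: inf.commute sup.commute)
  have S: "(sup x t, sup y t) \<in> ?\<theta>" if "(x, y) \<in> ?\<theta>" for x y t
  proof -
    have "R (sup (inf x y) t) (sup (sup x y) t)"
      using that by (intro sup) (auto simp: le_supI1)
    then have "R (inf (sup x t) (sup y t)) (sup (sup x t) (sup y t))"
      by (rule convex) (auto simp: le_supI1 le_supI2 le_infI1 le_infI2)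
    then show ?thesis by simp
  qed
  have I: "(inf x t, inf y t) \<in> ?\<theta>" if "(x, y) \<in> ?\<theta>" for x y t
  proof -
    have "R (inf (inf x y) t) (inf (sup x y) t)"
      using that by (intro inf) (auto simp: le_supI1)
    then have "R (inf (inf x t) (inf y t)) (sup (inf x t) (inf y t))"
      by (rule convex) (auto simp: le_supI1 le_supI2 le_infI1 le_infI2)
    then show ?thesis by simp
  qed
  have "refl ?\<theta>" using refl by (auto intro: refl_onI)
  moreover have "sym ?\<theta>" by (rule symI) (rule sy)
  moreover have "trans ?\<theta>" by (rule transI) (rule tr)
  ultimately have "equiv UNIV ?\<theta>" by (simp add: equiv_def)
  moreover have "(inf a b, inf a' b') \<in> ?\<theta>" "(sup a b, sup a' b') \<in> ?\<theta>"
    if "(a, a') \<in> ?\<theta>" "(b, b') \<in> ?\<theta>" for a a' b b'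
    using tr[OF I[OF that(1), of b] I[OF that(2), of a', unfolded inf.commute[of _ a']]]
      tr[OF S[OF that(1), of b] S[OF that(2), of a', unfolded sup.commute[of _ a']]]
    by blast+
  ultimately show ?thesis unfolding lattice_congruence_def by blast
qed


section \<open>Principal congruences and compactness\<close>

definition principal_con :: "'a::lattice \<Rightarrow> 'a \<Rightarrow> 'a con" where
  "principal_con x y = Inf {\<theta>. (x, y) \<in> Rep_con \<theta>}"

lemma principal_con_le_iff: "principal_con x y \<le> \<theta> \<longleftrightarrow> (x, y) \<in> Rep_con \<theta>"
proof
  have "(x, y) \<in> Rep_con (principal_con x y)"
    by (simp add: principal_con_def Inf_con.rep_eq)
  then show "principal_con x y \<le> \<theta> \<Longrightarrow> (x, y) \<in> Rep_con \<theta>" by (rule Rep_con_mono[rotated])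
  show "(x, y) \<in> Rep_con \<theta> \<Longrightarrow> principal_con x y \<le> \<theta>"
    unfolding principal_con_def by (rule Inf_lower) simp
qed

lemma in_principal_con: "(x, y) \<in> Rep_con (principal_con x y)"
  using principal_con_le_iff[of x y] by blast

lemma principal_con_eqI:
  assumes "\<And>\<theta>. (x, y) \<in> Rep_con \<theta> \<longleftrightarrow> (x', y') \<in> Rep_con \<theta>"
  shows "principal_con x y = principal_con x' y'"
  using assms by (simp add: principal_con_def)

lemma con_leI_intervals:
  assumes "\<And>x y. x \<le> y \<Longrightarrow> (x, y) \<in> Rep_con \<theta> \<Longrightarrow> (x, y) \<in> Rep_con \<psi>"
  shows "\<theta> \<le> \<psi>"
proof -
  have "(x, y) \<in> Rep_con \<psi>" if "(x, y) \<in> Rep_con \<theta>" for x y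
    using assms[of "inf x y" "sup x y"] that by (simp add: Rep_con_inf_sup le_supI1)
  then show ?thesis by (auto simp: less_eq_con.rep_eq)
qed

text \<open>The joins of finite subsets of \<open>A\<close> form a directed family, and a directed
  union of congruences is a congruence. This union contains each member of \<open>A\<close>, hence
  also \<open>Sup A\<close>.\<close>

lemma Rep_con_Sup_finite:
  assumes "(x, y) \<in> Rep_con (Sup A)"
  shows "\<exists>F. finite F \<and> F \<subseteq> A \<and> (x, y) \<in> Rep_con (Sup F)"
proof -
  let ?U = "{(x, y). \<exists>F. finite F \<and> F \<subseteq> A \<and> (x, y) \<in> Rep_con (Sup F)}"
  have directed: "\<exists>F. finite F \<and> F \<subseteq> A \<and> p \<in> Rep_con (Sup F) \<and> q \<in> Rep_con (Sup F)"
    if pq: "p \<in> ?U" "q \<in> ?U" for p q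
  proof -
    obtain F G where F: "finite F" "F \<subseteq> A" "p \<in> Rep_con (Sup F)"
      and G: "finite G" "G \<subseteq> A" "q \<in> Rep_con (Sup G)"
      using pq by auto
    have "Sup F \<le> Sup (F \<union> G)" "Sup G \<le> Sup (F \<union> G)" by (simp_all add: Sup_subset_mono)
    then have "p \<in> Rep_con (Sup (F \<union> G))" "q \<in> Rep_con (Sup (F \<union> G))"
      using F(3) G(3) by (auto simp: less_eq_con.rep_eq)
    then show ?thesis using F G by (intro exI[of _ "F \<union> G"]) auto
  qed
  have "refl ?U" by (auto intro!: refl_onI exI[of _ "{}"])
  moreover have "sym ?U" by (auto intro!: symI dest: Rep_con_sym)
  moreover have "trans ?U"
  proof (rule transI)
    fix x y z assume "(x, y) \<in> ?U" "(y, z) \<in> ?U"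
    from directed[OF this] show "(x, z) \<in> ?U" by (auto dest: Rep_con_trans)
  qed
  moreover have "(inf a b, inf a' b') \<in> ?U \<and> (sup a b, sup a' b') \<in> ?U"
    if "(a, a') \<in> ?U" "(b, b') \<in> ?U" for a a' b b'
    using directed[OF that] by (auto dest: Rep_con_inf Rep_con_sup)
  ultimately have U: "lattice_congruence ?U"
    unfolding lattice_congruence_def equiv_def by blast
  have "Sup A \<le> Abs_con ?U"
  proof (rule Sup_least)
    fix \<theta> assume "\<theta> \<in> A"
    then have "Rep_con \<theta> \<subseteq> ?U" by (auto intro!: exI[of _ "{\<theta>}"])
    then show "\<theta> \<le> Abs_con ?U" using U by (simp add: less_eq_con.rep_eq Abs_con_inverse)
  qed
  then have "(x, y) \<in> ?U"
    using assms U by (auto simp: less_eq_con.rep_eq Abs_con_inverse)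
  then show ?thesis by simp
qed

lemma compact_principal_con: "compact_element (principal_con x y)"
  unfolding compact_element_def principal_con_le_iff using Rep_con_Sup_finite by blast

text \<open>Every congruence is the join of the principal congruences of its pairs; compactness
  selects finitely many of them.\<close>

lemma compact_con_finitely_generated:
  assumes "compact_element \<theta>"
  shows "\<exists>F. finite F \<and> \<theta> = Sup ((\<lambda>(x, y). principal_con x y) ` F)"
proof -
  let ?P = "\<lambda>(x, y). principal_con x y"
  have "\<theta> \<le> Sup (?P ` Rep_con \<theta>)"
  proof (rule con_leI_intervals)
    fix x y assume "(x, y) \<in> Rep_con \<theta>"
    then have "principal_con x y \<le> Sup (?P ` Rep_con \<theta>)" by (auto intro: Sup_upper)
    then show "(x, y) \<in> Rep_con (Sup (?P ` Rep_con \<theta>))" by (simp add: principal_con_le_iff)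
  qed
  then obtain G where G: "finite G" "G \<subseteq> ?P ` Rep_con \<theta>" "\<theta> \<le> Sup G"
    using assms unfolding compact_element_def by meson
  then obtain F where F: "F \<subseteq> Rep_con \<theta>" "finite F" "G = ?P ` F"
    using finite_subset_image[of G ?P "Rep_con \<theta>"] by blast
  have "Sup (?P ` F) \<le> \<theta>" using F by (auto intro!: Sup_least simp: principal_con_le_iff)
  then show ?thesis using F G by (auto intro!: exI[of _ F])
qed

text \<open>The common lower end \<open>u\<close> is what keeps the join principal: joining the two
  related pairs leaves \<open>u\<close> fixed. Generators are therefore first moved to a common
  bottom.\<close>

lemma principal_con_sup_lower:
  assumes "u \<le> x" "u \<le> y"
  shows "sup (principal_con u x) (principal_con u y) = principal_con u (sup x y)"
proof (rule antisym)
  have "(u, x) \<in> Rep_con (principal_con u (sup x y))" "(u, y) \<in> Rep_con (principal_con u (sup x y))"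
    using assms by (auto intro: Rep_con_convex[OF in_principal_con])
  then show "sup (principal_con u x) (principal_con u y) \<le> principal_con u (sup x y)"
    by (simp add: principal_con_le_iff)
  let ?\<psi> = "sup (principal_con u x) (principal_con u y)"
  have "(u, x) \<in> Rep_con ?\<psi>" "(u, y) \<in> Rep_con ?\<psi>"
    by (simp_all flip: principal_con_le_iff)
  then have "(sup u u, sup x y) \<in> Rep_con ?\<psi>" by (rule Rep_con_sup)
  then show "principal_con u (sup x y) \<le> ?\<psi>" by (simp add: principal_con_le_iff)
qed


section \<open>Relatively complemented lattices\<close>

lemma relatively_complementedE:
  fixes a b c :: "'a::lattice"
  assumes "relatively_complemented TYPE('a)" "a \<le> b" "b \<le> c"
  obtains x where "a \<le> x" "x \<le> c" "inf b x = a" "sup b x = c"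
  using assms unfolding relatively_complemented_def by metis

lemma interval_to_bottom:
  fixes u :: "'a::lattice"
  assumes "relatively_complemented TYPE('a)" "u \<le> x" "x \<le> y" "y \<le> v"
  obtains w where "u \<le> w" "w \<le> v"
    "\<And>\<theta>. (x, y) \<in> Rep_con \<theta> \<longleftrightarrow> (u, w) \<in> Rep_con \<theta>"
proof -
  \<comment> \<open>A complement \<open>w\<close> of \<open>x\<close> in [u,y] makes [u,w] and [x,y]
    transposes of each other, so the same congruences collapse them.\<close>
  obtain w where w: "u \<le> w" "w \<le> y" "inf x w = u" "sup x w = y"
    using relatively_complementedE[OF assms(1-3)] .
  then show thesis
    using assms(4) Rep_con_complement[of w x u y] that[of w]
    by (simp add: inf.commute sup.commute)
qed

lemma interval_to_top:
  fixes u :: "'a::lattice"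
  assumes "relatively_complemented TYPE('a)" "u \<le> x" "x \<le> y" "y \<le> v"
  obtains w where "u \<le> w" "w \<le> v"
    "\<And>\<theta>. (x, y) \<in> Rep_con \<theta> \<longleftrightarrow> (w, v) \<in> Rep_con \<theta>"
proof -
  obtain w where w: "x \<le> w" "w \<le> v" "inf y w = x" "sup y w = v"
    using relatively_complementedE[OF assms(1) assms(3,4)] .
  then show thesis
    using assms(2) Rep_con_complement[of y w x v] that[of w] by simp
qed

section \<open>Permutability of congruences\<close>

lemma congruences_permute_on_chain:
  fixes x y z :: "'a::lattice"
  assumes "relatively_complemented TYPE('a)" "x \<le> y" "y \<le> z"
    and "(x, y) \<in> Rep_con \<theta>" "(y, z) \<in> Rep_con \<psi>"
  obtains w where "(x, w) \<in> Rep_con \<psi>" "(w, z) \<in> Rep_con \<theta>"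
proof -
  \<comment> \<open>For a complement \<open>w\<close> of \<open>y\<close> in [x,z], the intervals
    [x,w] and [y,z] are transposes, and so are [w,z] and [x,y]. Going through \<open>w\<close>
    instead of \<open>y\<close> thus swaps the two congruences.\<close>
  obtain w where w: "x \<le> w" "w \<le> z" "inf y w = x" "sup y w = z"
    using relatively_complementedE[OF assms(1-3)] .
  then show thesis
    using assms(4,5) Rep_con_complement[of y w x z] Rep_con_complement[of w y x z] that[of w]
    by (simp add: inf.commute sup.commute)
qed

text \<open>The chain case is applied twice below the common upper bound \<open>?t\<close>, once
  starting from \<open>x\<close> and once from \<open>z\<close>. The meet of the two resulting
  elements is the required one.\<close>

lemma congruences_permute:
  fixes x y z :: "'a::lattice"
  assumes "relatively_complemented TYPE('a)"
    and xy: "(x, y) \<in> Rep_con \<theta>" and yz: "(y, z) \<in> Rep_con \<psi>"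
  obtains w where "(x, w) \<in> Rep_con \<psi>" "(w, z) \<in> Rep_con \<theta>"
proof -
  let ?t = "sup (sup x y) z"
  have "(x, sup x y) \<in> Rep_con \<theta>"
    using Rep_con_sup[OF Rep_con_refl[of x] xy] by simp
  moreover have "(sup x y, ?t) \<in> Rep_con \<psi>"
    using Rep_con_sup[OF Rep_con_refl[of "sup x y"] yz] by (simp add: sup.assoc)
  ultimately obtain w where w: "(x, w) \<in> Rep_con \<psi>" "(w, ?t) \<in> Rep_con \<theta>"
    using congruences_permute_on_chain[OF assms(1), of x "sup x y" ?t] by auto
  have "(z, sup y z) \<in> Rep_con \<psi>"
    using Rep_con_sup[OF Rep_con_sym[OF yz] Rep_con_refl[of z]] by simp
  moreover have "(sup y z, ?t) \<in> Rep_con \<theta>"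
    using Rep_con_sup[OF Rep_con_sym[OF xy] Rep_con_refl[of "sup y z"]] by (simp add: sup.assoc)
  ultimately obtain w' where w': "(z, w') \<in> Rep_con \<theta>" "(w', ?t) \<in> Rep_con \<psi>"
    using congruences_permute_on_chain[OF assms(1), of z "sup y z" ?t]
    by (auto simp: sup.assoc)
  have "(inf x ?t, inf w w') \<in> Rep_con \<psi>"
    using w(1) Rep_con_sym[OF w'(2)] by (rule Rep_con_inf)
  moreover have "(inf w w', inf ?t z) \<in> Rep_con \<theta>"
    using w(2) Rep_con_sym[OF w'(1)] by (rule Rep_con_inf)
  moreover have "inf x ?t = x" "inf ?t z = z"
    by (simp_all add: inf_absorb1 inf_absorb2 le_supI1)
  ultimately show thesis using that by simp
qed

text \<open>Permutability makes the relational product symmetric and transitive, so it is a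
  congruence above both factors.\<close>

lemma Rep_con_sup_relcomp:
  assumes rc: "relatively_complemented TYPE('a::lattice)"
  shows "Rep_con (sup \<theta> \<psi> :: 'a con) \<subseteq> Rep_con \<theta> O Rep_con \<psi>"
proof -
  let ?C = "Rep_con \<theta> O Rep_con \<psi>"
  have "(y, x) \<in> ?C" if xy: "(x, y) \<in> ?C" for x y
  proof -
    obtain m where m: "(x, m) \<in> Rep_con \<theta>" "(m, y) \<in> Rep_con \<psi>" using xy by auto
    obtain w where "(x, w) \<in> Rep_con \<psi>" "(w, y) \<in> Rep_con \<theta>"
      using congruences_permute[OF rc m] .
    then show ?thesis using Rep_con_sym by blast
  qed
  then have "sym ?C" by (rule symI)
  moreover have "refl ?C" by (auto intro!: refl_onI relcompI[OF Rep_con_refl Rep_con_refl])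
  moreover have "(x, z) \<in> ?C" if xy: "(x, y) \<in> ?C" and yz: "(y, z) \<in> ?C" for x y z
  proof -
    obtain m n where m: "(x, m) \<in> Rep_con \<theta>" "(m, y) \<in> Rep_con \<psi>"
      and n: "(y, n) \<in> Rep_con \<theta>" "(n, z) \<in> Rep_con \<psi>" using xy yz by auto
    obtain w where "(m, w) \<in> Rep_con \<theta>" "(w, n) \<in> Rep_con \<psi>"
      using congruences_permute[OF rc m(2) n(1)] .
    then show ?thesis using m n by (blast intro: Rep_con_trans)
  qed
  then have "trans ?C" by (rule transI)
  moreover have "(inf a b, inf a' b') \<in> ?C \<and> (sup a b, sup a' b') \<in> ?C"
    if "(a, a') \<in> ?C" "(b, b') \<in> ?C" for a a' b b'
    using that by (blast intro: Rep_con_inf Rep_con_sup)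
  ultimately have C: "lattice_congruence ?C"
    unfolding lattice_congruence_def equiv_def by blast
  have "\<theta> \<le> Abs_con ?C" "\<psi> \<le> Abs_con ?C"
    using C by (auto simp: less_eq_con.rep_eq Abs_con_inverse intro: relcompI[OF _ Rep_con_refl]
      relcompI[OF Rep_con_refl])
  then have "sup \<theta> \<psi> \<le> Abs_con ?C" by simp
  then show ?thesis using C by (simp add: less_eq_con.rep_eq Abs_con_inverse)
qed

section \<open>Compact congruences as principal congruences\<close>

lemma compact_con_principal:
  fixes \<theta> :: "'a::lattice con"
  assumes rc: "relatively_complemented TYPE('a)" and "compact_element \<theta>"
  obtains u v where "u \<le> v" "\<theta> = principal_con u v"
proof -
  let ?P = "\<lambda>(x :: 'a, y). principal_con x y"
  have "\<exists>u v. u \<le> v \<and> Sup (?P ` F) = principal_con u v" if "finite F" for F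
    using that
  proof induction
    case empty
    have "principal_con x x = bot" for x :: 'a
      by (simp add: principal_con_le_iff flip: bot.extremum_unique)
    then show ?case by (metis Sup_empty image_empty order.refl)
  next
    case (insert p F)
    then obtain u v where uv: "u \<le> v" "Sup (?P ` F) = principal_con u v" by auto
    obtain x y where p: "p = (x, y)" by force
    \<comment> \<open>The interval from \<open>?o\<close> to \<open>?i\<close> contains both the
      interval found so far and that of the new generator. Both are moved down to start at
      \<open>?o\<close>, where their congruences join to a principal one.\<close>
    let ?o = "inf u (inf x y)" and ?i = "sup v (sup x y)"
    obtain w where w: "?o \<le> w" "w \<le> ?i"
      "\<And>\<theta>. (u, v) \<in> Rep_con \<theta> \<longleftrightarrow> (?o, w) \<in> Rep_con \<theta>"
      using interval_to_bottom[OF rc _ uv(1), of ?o ?i] by auto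
    obtain w' where w': "?o \<le> w'" "w' \<le> ?i"
      "\<And>\<theta>. (inf x y, sup x y) \<in> Rep_con \<theta> \<longleftrightarrow> (?o, w') \<in> Rep_con \<theta>"
      by (rule interval_to_bottom[OF rc, of ?o "inf x y" "sup x y" ?i])
        (auto intro: le_infI2 le_supI1)
    have "principal_con u v = principal_con ?o w" "principal_con x y = principal_con ?o w'"
      using w(3) w'(3) by (auto intro!: principal_con_eqI simp: Rep_con_inf_sup)
    then have "Sup (?P ` insert p F) = principal_con ?o (sup w' w)"
      using uv p w(1) w'(1) by (simp add: principal_con_sup_lower)
    moreover have "?o \<le> sup w' w" using w by (simp add: le_supI2)
    ultimately show ?case by blast
  qed
  then show thesis using compact_con_finitely_generated[OF assms(2)] that by metis
qed

text \<open>
  The congruence constructed here is the relative pseudocomplement of \<open>\<theta>\<close> with respect to \<open>\<psi>\<close>: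
  a subinterval of a transposed interval can be moved to its top (or bottom) and then transposed
  back.
\<close>

lemma con_le_of_subintervals:
  fixes \<theta> \<psi> :: "'a::lattice con"
  assumes rc: "relatively_complemented TYPE('a)"
    and uv: "u \<le> v" "\<theta> \<le> principal_con u v"
    and local_le: "\<And>x y. u \<le> x \<Longrightarrow> x \<le> y \<Longrightarrow> y \<le> v \<Longrightarrow> (x, y) \<in> Rep_con \<theta> \<Longrightarrow> (x, y) \<in> Rep_con \<psi>"
  shows "\<theta> \<le> \<psi>"
proof -
  define R where "R p q \<longleftrightarrow> (\<forall>x y. p \<le> x \<longrightarrow> x \<le> y \<longrightarrow> y \<le> q \<longrightarrow>
    (x, y) \<in> Rep_con \<theta> \<longrightarrow> (x, y) \<in> Rep_con \<psi>)" for p q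
  let ?\<rho> = "{(x, y). R (inf x y) (sup x y)}"
  have "lattice_congruence ?\<rho>"
  proof (rule lattice_congruenceI_intervals)
    show "R x x" for x unfolding R_def by (metis Rep_con_refl order.trans antisym)
  next
    fix p q r assume pqr: "p \<le> q" "q \<le> r" and R: "R p q" "R q r"
    show "R p r" unfolding R_def
    proof (intro allI impI)
      fix x y assume xy: "p \<le> x" "x \<le> y" "y \<le> r" "(x, y) \<in> Rep_con \<theta>"
      obtain w where w: "p \<le> w" "w \<le> r"
        "\<And>\<theta>. (x, y) \<in> Rep_con \<theta> \<longleftrightarrow> (w, r) \<in> Rep_con \<theta>"
        using interval_to_top[OF rc xy(1-3)] by metis
      have wr: "(w, r) \<in> Rep_con \<theta>" using w xy by simp
      \<comment> \<open>The interval [w,r] is split at the join of \<open>q\<close> and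
        \<open>w\<close>. The upper piece lies in [q,r]; the lower one transposes down into
        [p,q].\<close>
      have "(sup q w, r) \<in> Rep_con \<theta>"
        by (rule Rep_con_convex[OF wr]) (use w pqr in auto)
      then have 1: "(sup q w, r) \<in> Rep_con \<psi>"
        using R(2) w pqr unfolding R_def by auto
      have "(w, sup q w) \<in> Rep_con \<theta>"
        by (rule Rep_con_convex[OF wr]) (use w pqr in auto)
      then have "(inf q w, q) \<in> Rep_con \<theta>" by (simp add: Rep_con_perspective)
      then have "(inf q w, q) \<in> Rep_con \<psi>"
        using R(1) w pqr unfolding R_def by auto
      then have "(w, sup q w) \<in> Rep_con \<psi>" by (simp add: Rep_con_perspective)
      then show "(x, y) \<in> Rep_con \<psi>" using 1 w(3) Rep_con_trans by blast
    qed
  next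
    fix p q t assume pq: "p \<le> q" and R: "R p q"
    show "R (sup p t) (sup q t)" unfolding R_def
    proof (intro allI impI)
      fix x y assume xy: "sup p t \<le> x" "x \<le> y" "y \<le> sup q t" "(x, y) \<in> Rep_con \<theta>"
      obtain w where w: "sup p t \<le> w" "w \<le> sup q t"
        "\<And>\<theta>. (x, y) \<in> Rep_con \<theta> \<longleftrightarrow> (w, sup q t) \<in> Rep_con \<theta>"
        using interval_to_top[OF rc xy(1-3)] by metis
      \<comment> \<open>Since \<open>w\<close> lies above \<open>t\<close>, the moved interval,
        unlike an arbitrary [x,y], is the transpose of an interval with top
        \<open>q\<close>.\<close>
      have "sup q w = sup q t"
        using w(1,2) by (intro antisym) (auto intro: le_supI2)
      then have *: "(x, y) \<in> Rep_con \<theta> \<longleftrightarrow> (inf q w, q) \<in> Rep_con \<theta>" for \<theta>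
        using w(3) by (simp add: Rep_con_perspective)
      then show "(x, y) \<in> Rep_con \<psi>" using R xy(4) w pq unfolding R_def by auto
    qed
    show "R (inf p t) (inf q t)" unfolding R_def
    proof (intro allI impI)
      fix x y assume xy: "inf p t \<le> x" "x \<le> y" "y \<le> inf q t" "(x, y) \<in> Rep_con \<theta>"
      obtain w where w: "inf p t \<le> w" "w \<le> inf q t"
        "\<And>\<theta>. (x, y) \<in> Rep_con \<theta> \<longleftrightarrow> (inf p t, w) \<in> Rep_con \<theta>"
        using interval_to_bottom[OF rc xy(1-3)] by metis
      have "inf w p = inf p t"
        using w(1,2) by (intro antisym) (auto intro: le_infI1)
      then have *: "(x, y) \<in> Rep_con \<theta> \<longleftrightarrow> (p, sup w p) \<in> Rep_con \<theta>" for \<theta>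
        using w(3) Rep_con_perspective[of w p \<theta>] by simp
      then show "(x, y) \<in> Rep_con \<psi>" using R xy(4) w pq unfolding R_def by auto
    qed
  qed
  then have rep: "Rep_con (Abs_con ?\<rho>) = ?\<rho>" by (simp add: Abs_con_inverse)
  have "(u, v) \<in> ?\<rho>"
    using uv(1) local_le by (simp add: R_def inf_absorb1 sup_absorb2)
  then have "principal_con u v \<le> Abs_con ?\<rho>" by (simp only: principal_con_le_iff rep)
  with uv(2) have "\<theta> \<le> Abs_con ?\<rho>" by (rule order.trans)
  then have sub: "Rep_con \<theta> \<subseteq> ?\<rho>" by (simp only: less_eq_con.rep_eq rep)
  show ?thesis
  proof (rule con_leI_intervals)
    fix x y assume xy: "x \<le> y" "(x, y) \<in> Rep_con \<theta>"
    have "(x, y) \<in> ?\<rho>" using sub xy(2) by (rule subsetD)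
    then have "R x y" using xy(1) by (simp add: inf_absorb1 sup_absorb2)
    then show "(x, y) \<in> Rep_con \<psi>" using xy unfolding R_def by simp
  qed
qed

text \<open>Each subinterval of [u,v] collapsed by \<open>\<theta>\<close> can be moved down to
  \<open>u\<close>, so \<open>\<theta>\<close> is the join of the congruences
  \<open>principal_con u s\<close> with \<open>s\<close> in \<open>?S\<close>. Compactness leaves
  finitely many, and since \<open>?S\<close> is closed under joins, a single \<open>s\<close>
  suffices.\<close>

lemma compact_con_le_principal:
  fixes \<theta> :: "'a::lattice con"
  assumes rc: "relatively_complemented TYPE('a)" and compact: "compact_element \<theta>"
    and uv: "u \<le> v" "\<theta> \<le> principal_con u v"
  obtains s where "u \<le> s" "s \<le> v" "\<theta> = principal_con u s"
proof -
  let ?S = "{s. u \<le> s \<and> s \<le> v \<and> (u, s) \<in> Rep_con \<theta>}"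
  have "\<theta> \<le> Sup (principal_con u ` ?S)"
  proof (rule con_le_of_subintervals[OF rc uv])
    fix x y assume xy: "u \<le> x" "x \<le> y" "y \<le> v" "(x, y) \<in> Rep_con \<theta>"
    obtain w where w: "u \<le> w" "w \<le> v"
      "\<And>\<theta>. (x, y) \<in> Rep_con \<theta> \<longleftrightarrow> (u, w) \<in> Rep_con \<theta>"
      using interval_to_bottom[OF rc xy(1-3)] by metis
    have "principal_con u w \<le> Sup (principal_con u ` ?S)"
      using w xy by (intro Sup_upper) auto
    then show "(x, y) \<in> Rep_con (Sup (principal_con u ` ?S))"
      by (simp add: w(3) principal_con_le_iff)
  qed
  then obtain G where G: "finite G" "G \<subseteq> principal_con u ` ?S" "\<theta> \<le> Sup G"
    using compact unfolding compact_element_def by meson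
  then obtain F where F: "F \<subseteq> ?S" "finite F" "G = principal_con u ` F"
    using finite_subset_image[of G "principal_con u" ?S] by blast
  have "\<exists>s\<in>?S. Sup (principal_con u ` F) \<le> principal_con u s"
    using F(2,1)
  proof induction
    case empty
    then show ?case using uv by (auto intro!: bexI[of _ u])
  next
    case (insert x F)
    then obtain s where s: "s \<in> ?S" "Sup (principal_con u ` F) \<le> principal_con u s" by auto
    have "(sup u u, sup x s) \<in> Rep_con \<theta>" using insert.prems s by (intro Rep_con_sup) auto
    then have "sup x s \<in> ?S" using insert.prems s by (auto simp: le_supI1)
    moreover have "Sup (principal_con u ` insert x F) \<le> principal_con u (sup x s)"
      using insert.prems s principal_con_sup_lower[of u x s, symmetric]
      by (auto simp: le_supI2)
    ultimately show ?case by blast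
  qed
  then obtain s where s: "s \<in> ?S" "\<theta> \<le> principal_con u s"
    using G(3) F(3) by (auto intro: order.trans)
  then have "\<theta> = principal_con u s" by (auto simp: principal_con_le_iff intro: antisym)
  then show thesis using that s(1) by blast
qed

lemma compact_con_sup_principal:
  fixes \<theta> \<psi> :: "'a::lattice con"
  assumes rc: "relatively_complemented TYPE('a)"
    and compact: "compact_element \<theta>" "compact_element \<psi>"
    and uv: "u \<le> v" "sup \<theta> \<psi> = principal_con u v"
  shows "\<exists>x y. u \<le> y \<and> y \<le> x \<and> x \<le> v \<and> \<theta> = principal_con u x \<and> \<psi> = principal_con y v"
proof -
  have le: "\<theta> \<le> principal_con u v" "\<psi> \<le> principal_con u v"
    unfolding uv(2)[symmetric] by simp_all
  obtain s where s: "u \<le> s" "s \<le> v" "\<theta> = principal_con u s"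
    using compact_con_le_principal[OF rc compact(1) uv(1) le(1)] .
  obtain t' where t': "u \<le> t'" "t' \<le> v" "\<psi> = principal_con u t'"
    using compact_con_le_principal[OF rc compact(2) uv(1) le(2)] .
  \<comment> \<open>The congruence \<open>\<psi>\<close> has to be generated at the top end, so its
    interval is moved from \<open>u\<close> up to \<open>v\<close>.\<close>
  obtain t where t: "u \<le> t" "t \<le> v"
    "\<And>\<theta>. (u, t') \<in> Rep_con \<theta> \<longleftrightarrow> (t, v) \<in> Rep_con \<theta>"
    using interval_to_top[OF rc order.refl t'(1,2)] by metis
  have psi: "\<psi> = principal_con t v" using t'(3) principal_con_eqI[OF t(3)] by simp
  have "(u, v) \<in> Rep_con (sup \<theta> \<psi>)" unfolding uv(2) by (rule in_principal_con)
  then obtain z where z: "(u, z) \<in> Rep_con \<theta>" "(z, v) \<in> Rep_con \<psi>"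
    using Rep_con_sup_relcomp[OF rc, of \<theta> \<psi>] by auto
  \<comment> \<open>Permutability does not place \<open>z\<close> in [u,v]. Joining with
    \<open>u\<close> and meeting with \<open>v\<close> forces it there; this polynomial fixes
    \<open>u\<close> and \<open>v\<close>, so both relations survive.\<close>
  define m where "m = inf (sup z u) v"
  have m: "u \<le> m" "m \<le> v" using uv(1) by (auto simp: m_def)
  have "(inf (sup u u) v, m) \<in> Rep_con \<theta>"
    unfolding m_def using z(1) by (intro Rep_con_inf Rep_con_sup) auto
  then have um: "(u, m) \<in> Rep_con \<theta>" using uv(1) by (simp add: inf_absorb1)
  have "(m, inf (sup v u) v) \<in> Rep_con \<psi>"
    unfolding m_def using z(2) by (intro Rep_con_inf Rep_con_sup) auto
  then have mv: "(m, v) \<in> Rep_con \<psi>" using uv(1) by (simp add: inf_absorb2)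
  \<comment> \<open>Joining \<open>m\<close> with \<open>s\<close> stays in the
    \<open>\<theta>\<close>-class of \<open>u\<close> and reaches far enough to generate all of
    \<open>\<theta>\<close>. Dually, \<open>m\<close> is met with \<open>t\<close> for
    \<open>\<psi>\<close>; the two new elements are comparable because \<open>m\<close> lies between
    them.\<close>
  have "(sup u u, sup m s) \<in> Rep_con \<theta>"
    using um s(3) in_principal_con by (intro Rep_con_sup) auto
  then have "principal_con u (sup m s) \<le> \<theta>" by (simp add: principal_con_le_iff)
  moreover have "\<theta> \<le> principal_con u (sup m s)"
    unfolding s(3) principal_con_le_iff by (rule Rep_con_convex[OF in_principal_con]) (use s in auto)
  ultimately have x: "\<theta> = principal_con u (sup m s)" by simp
  have "(inf m t, inf v v) \<in> Rep_con \<psi>"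
    using mv psi in_principal_con by (intro Rep_con_inf) auto
  then have "principal_con (inf m t) v \<le> \<psi>" by (simp add: principal_con_le_iff)
  moreover have "\<psi> \<le> principal_con (inf m t) v"
    unfolding psi principal_con_le_iff by (rule Rep_con_convex[OF in_principal_con]) (use t in auto)
  ultimately have y: "\<psi> = principal_con (inf m t) v" by simp
  show ?thesis
    using x y m s t by (intro exI[of _ "sup m s"] exI[of _ "inf m t"]) (auto simp: le_supI1 le_infI1)
qed


section \<open>The refinement property\<close>

lemma principal_con_refinement:
  fixes x y :: "'i \<Rightarrow> 'a::lattice"
  assumes chain: "u \<le> y i" "y i \<le> x i" "x i \<le> v" "u \<le> y j" "y j \<le> x j" "x j \<le> v"
  defines "c \<equiv> \<lambda>i j. principal_con (inf (x i) (y j)) (x i)"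
  shows "c i j \<le> principal_con u (x i)" "c i j \<le> principal_con (y j) v"
    and "principal_con u (x i) \<le> sup (principal_con u (x j)) (c i j)"
    and "principal_con (y j) v \<le> sup (principal_con (y i) v) (c i j)"
    and "c i k \<le> sup (c i j) (c j k)"
proof -
  have ux: "u \<le> x i" and yv: "y j \<le> v" using chain by (auto intro: order.trans)
  show "c i j \<le> principal_con u (x i)"
    unfolding c_def principal_con_le_iff
    by (rule Rep_con_convex[OF in_principal_con]) (use chain ux in auto)
  \<comment> \<open>By perspectivity \<open>c i j\<close> is also generated by \<open>y j\<close>
    and the join of \<open>x i\<close> and \<open>y j\<close>, an interval inside [y j, v].\<close>
  show "c i j \<le> principal_con (y j) v"
    unfolding c_def principal_con_le_iff Rep_con_perspective
    by (rule Rep_con_convex[OF in_principal_con]) (use chain yv in auto)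
  let ?\<psi> = "sup (principal_con u (x j)) (c i j)"
  \<comment> \<open>From \<open>u\<close> to \<open>x i\<close> in two steps: the first stays below
    \<open>x j\<close> because \<open>y j\<close> does, the second is collapsed by
    \<open>c i j\<close>.\<close>
  have "(u, inf (x i) (y j)) \<in> Rep_con ?\<psi>"
    by (rule Rep_con_convex[OF Rep_con_mono[OF sup_ge1 in_principal_con]])
      (use chain ux in \<open>auto intro: le_infI2\<close>)
  moreover have "(inf (x i) (y j), x i) \<in> Rep_con ?\<psi>"
    by (simp add: c_def flip: principal_con_le_iff)
  ultimately show "principal_con u (x i) \<le> ?\<psi>"
    unfolding principal_con_le_iff by (rule Rep_con_trans)
  let ?\<chi> = "sup (principal_con (y i) v) (c i j)"
  \<comment> \<open>Dually, the join of \<open>x i\<close> and \<open>y j\<close> lies above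
    \<open>y i\<close> because \<open>x i\<close> does.\<close>
  have "(sup (x i) (y j), v) \<in> Rep_con ?\<chi>"
    by (rule Rep_con_convex[OF Rep_con_mono[OF sup_ge1 in_principal_con]])
      (use chain yv in \<open>auto intro: le_supI1\<close>)
  moreover have "(y j, sup (x i) (y j)) \<in> Rep_con ?\<chi>"
    unfolding Rep_con_perspective[symmetric] by (simp add: c_def flip: principal_con_le_iff)
  ultimately show "principal_con (y j) v \<le> ?\<chi>"
    unfolding principal_con_le_iff by (blast intro: Rep_con_trans)
  let ?\<eta> = "sup (c i j) (c j k)"
  have ij: "(inf (x i) (y j), x i) \<in> Rep_con ?\<eta>"
    and jk: "(inf (x j) (y k), x j) \<in> Rep_con ?\<eta>"
    by (simp_all add: c_def flip: principal_con_le_iff)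
  let ?p = "inf (x i) (y j)"
  \<comment> \<open>Meeting with \<open>?p\<close>, which is below \<open>y j\<close> and so below
    \<open>x j\<close>, turns the second relation into one with upper end \<open>?p\<close>, where
    the first continues to \<open>x i\<close>. The resulting interval contains the one that
    generates \<open>c i k\<close>.\<close>
  have "(inf ?p (inf (x j) (y k)), inf ?p (x j)) \<in> Rep_con ?\<eta>"
    using jk by (intro Rep_con_inf) auto
  moreover have "inf ?p (x j) = ?p" using chain by (simp add: inf_absorb1 le_infI2)
  ultimately have "(inf ?p (inf (x j) (y k)), x i) \<in> Rep_con ?\<eta>"
    using ij by (auto intro: Rep_con_trans)
  then have "(inf (x i) (y k), x i) \<in> Rep_con ?\<eta>"
    by (rule Rep_con_convex) (auto intro: le_infI1 le_infI2)
  then show "c i k \<le> ?\<eta>" unfolding principal_con_le_iff[symmetric] by (simp only: c_def)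
qed

theorem proposition2p10:
  assumes "relatively_complemented TYPE('a::lattice)"
  shows "URP_plus TYPE('i) TYPE('a con_c)"
  unfolding URP_plus_def URP_plus_at_def
proof (intro allI impI)
  fix e :: "'a con_c" and I :: "'i set" and a b :: "'i \<Rightarrow> 'a con_c"
  assume ab: "\<forall>i\<in>I. sup (a i) (b i) = e"
  have compact: "compact_element (Rep_con_c \<theta>)" for \<theta> :: "'a con_c"
    using Rep_con_c by blast
  \<comment> \<open>The interval [u,v] depends on \<open>e\<close> alone, so one interval serves all
    indices and the \<open>x i\<close> and \<open>y j\<close> can be compared across the
    family.\<close>
  obtain u v where uv: "u \<le> v" "Rep_con_c e = principal_con u v"
    using compact_con_principal[OF assms compact] .
  have "\<forall>i\<in>I. \<exists>x y. u \<le> y \<and> y \<le> x \<and> x \<le> v \<and>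
    Rep_con_c (a i) = principal_con u x \<and> Rep_con_c (b i) = principal_con y v"
    using ab uv by (auto intro!: compact_con_sup_principal[OF assms compact compact]
      simp flip: sup_con_c.rep_eq)
  then obtain x y where chain: "\<And>i. i \<in> I \<Longrightarrow> u \<le> y i" "\<And>i. i \<in> I \<Longrightarrow> y i \<le> x i"
      "\<And>i. i \<in> I \<Longrightarrow> x i \<le> v"
    and reps: "\<And>i. i \<in> I \<Longrightarrow> Rep_con_c (a i) = principal_con u (x i)"
      "\<And>i. i \<in> I \<Longrightarrow> Rep_con_c (b i) = principal_con (y i) v"
    by metis
  define c where "c i j = Abs_con_c (principal_con (inf (x i) (y j)) (x i))" for i j
  have c: "Rep_con_c (c i j) = principal_con (inf (x i) (y j)) (x i)" for i j
    by (simp add: c_def Abs_con_c_inverse compact_principal_con)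
  show "\<exists>c. (\<forall>i\<in>I. \<forall>j\<in>I. c i j \<le> a i \<and> c i j \<le> b j) \<and>
    (\<forall>i\<in>I. \<forall>j\<in>I. a i \<le> sup (a j) (c i j) \<and> b j \<le> sup (b i) (c i j)) \<and>
    (\<forall>i\<in>I. \<forall>j\<in>I. \<forall>k\<in>I. c i k \<le> sup (c i j) (c j k))"
    by (intro exI[of _ c] conjI ballI)
      (simp_all add: less_eq_con_c.rep_eq sup_con_c.rep_eq c reps
        principal_con_refinement[where x = x and y = y and u = u and v = v] chain)
qed

end
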